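(* We have $$\log\frac{\pi}{2} \ = \ \sum_{k=1}^\infty \frac{\zeta(2k)}{4^k\cdot k} \ = \ -\sum_{k=1}^\infty \frac{(-1)^k B_{2k}}{2k\cdot (2k)!}\cdot \pi^{2k},$$ where $\zeta$ is the Riemann zeta function and $B_{2k}$ are the Bernoulli numbers.
   Context: Here $\log$ is the natural logarithm. The Riemann zeta function is $\zeta(s)=\sum_{n=1}^\infty n^{-s}$ for real part of $s$ greater than $1$. The Bernoulli numbers $B_k$ ($k\ge 2$) are the coefficients in the Taylor series at $t=0$: $$\frac{t}{e^t-1} = 1-\frac{t}{2}+\sum_{k=2}^\infty \frac{B_k t^k}{k!}.$$ *)

theory Defs
  imports "HOL-Analysis.Analysis"
begin

text \<open>
  The Dirichlet series of the Riemann zeta function. It converges, and so carries its meaning,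
  only for \<open>Re s > 1\<close>; elsewhere \<open>suminf\<close> returns an unspecified value.
\<close>

definition zeta :: "complex \<Rightarrow> complex" where
  "zeta s = (\<Sum>n. of_nat (Suc n) powr (-s))"

text \<open>
  \<open>fps_X\<close> and \<open>fps_exp 1 - 1\<close> both have subdegree 1, so the quotient is exact and is the
  Taylor series of \<open>t / (exp t - 1)\<close> at its removable singularity \<open>t = 0\<close>.
  The indices \<open>0\<close> and \<open>1\<close> are included: \<open>bernoulli 0 = 1\<close> and \<open>bernoulli 1 = - 1 / 2\<close>.
\<close>

definition bernoulli :: "nat \<Rightarrow> real" where
  "bernoulli k = fact k * fps_nth (fps_X / (fps_exp 1 - 1)) k"

lemma bernoulli_taylor:
  "(\<lambda>t::real. if t = 0 then 1 else t / (exp t - 1)) has_fps_expansion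
     Abs_fps (\<lambda>k. bernoulli k / fact k)"
proof -
  have sub: "subdegree (fps_exp 1 - 1 :: real fps) = 1"
    by (rule subdegreeI) auto
  have nz: "(fps_exp 1 - 1 :: real fps) \<noteq> 0"
    using sub by auto
  have "(\<lambda>t::real. if t = 0 then 1 else t / (exp t - 1)) has_fps_expansion
          (fps_X / (fps_exp 1 - 1) :: real fps)"
    by (rule has_fps_expansion_divide)
       (use sub nz in \<open>auto intro: has_fps_expansion_fps_X has_fps_expansion_diff
                               has_fps_expansion_exp1 has_fps_expansion_1\<close>)
  then show ?thesis
    by (simp add: bernoulli_def fps_nth_inverse)
qed

end

theory Submission
  imports Defs
begin

text \<open>
  Taking logarithms in Euler's product for the sine, expanding each factor and exchanging the two
  summations (all terms are nonnegative) gives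
  \<open>- ln (sin (\<pi> x) / (\<pi> x)) = (\<Sum>k\<ge>1. \<zeta>(2k) x\<^sup>2\<^sup>k / k)\<close> for \<open>0 < \<bar>x\<bar> < 1\<close>; the case \<open>x = 1/2\<close> is the first series.
  Differentiating, \<open>\<pi> x cot (\<pi> x) = 1 - 2 (\<Sum>k\<ge>1. \<zeta>(2k) x\<^sup>2\<^sup>k)\<close>. On the other hand
  \<open>\<pi> x cot (\<pi> x) = t / (exp t - 1) + t / 2\<close> with \<open>t = 2 \<pi> \<i> x\<close>, so comparing coefficients expresses
  \<open>\<zeta>(2k)\<close> by Bernoulli numbers and turns the first series into the second.
\<close>

section \<open>Logarithm of Euler's product for the sine\<close>

lemma log_sine_zeta_series:
  fixes x :: real
  assumes x: "\<bar>x\<bar> < 1" "x \<noteq> 0"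
  shows "(\<lambda>k. (\<Sum>n. 1 / real (Suc n) ^ (2 * Suc k)) * x ^ (2 * Suc k) / real (Suc k))
           sums - ln (sin (pi * x) / (pi * x))"
proof -
  \<comment> \<open>Row \<open>n\<close> is the series of \<open>- ln (1 - y)\<close> at
    \<open>y = x^2 / (n + 1)^2\<close>, the \<open>y\<close> of one Euler factor; column
    \<open>k\<close> sums to the zeta term with exponent \<open>2 * Suc k\<close>.\<close>
  define a :: "nat \<times> nat \<Rightarrow> real"
    where "a = (\<lambda>(n, k). (x\<^sup>2 / (real (Suc n))\<^sup>2) ^ Suc k / real (Suc k))"
  have x2: "x\<^sup>2 < 1"
    using x by (simp add: abs_square_less_1)
  have q: "0 \<le> x\<^sup>2 / (real (Suc n))\<^sup>2" "x\<^sup>2 / (real (Suc n))\<^sup>2 < 1" for n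
  proof -
    have "(1::real) \<le> (real (Suc n))\<^sup>2" by simp
    then show "x\<^sup>2 / (real (Suc n))\<^sup>2 < 1" using x2
      by (subst divide_less_eq_1_pos) (auto intro: less_le_trans simp del: of_nat_Suc)
  qed simp
  have a_nonneg: "a p \<ge> 0" for p
    unfolding a_def by (auto split: prod.split)
  have rows: "((\<lambda>k. a (n, k)) has_sum - ln (1 - x\<^sup>2 / (real (Suc n))\<^sup>2)) UNIV" for n
  proof (rule sums_nonneg_imp_has_sum)
    define y where "y = x\<^sup>2 / (real (Suc n))\<^sup>2"
    have "(\<lambda>k. - ((- (- y)) ^ k) / real k) sums ln (1 + - y)"
      by (rule ln_series') (use q[of n] in \<open>simp add: y_def\<close>)
    from sums_minus[OF this] have "(\<lambda>k. y ^ k / real k) sums - ln (1 - y)" by simp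
    \<comment> \<open>Division by zero yields 0, so the term at \<open>k = 0\<close> vanishes and
      the index shift keeps the sum.\<close>
    then have "(\<lambda>k. y ^ Suc k / real (Suc k)) sums - ln (1 - y)"
      by (subst sums_Suc_iff) simp
    then show "(\<lambda>k. a (n, k)) sums - ln (1 - x\<^sup>2 / (real (Suc n))\<^sup>2)"
      by (simp only: a_def y_def prod.case)
  qed (rule a_nonneg)
  have "(\<lambda>n. - ln (1 - x\<^sup>2 / (real (Suc n))\<^sup>2)) sums - ln (sin (pi * x) / (pi * x))"
    unfolding sums_def
  proof -
    have P: "(\<lambda>n. \<Prod>k=1..n. 1 - x\<^sup>2 / (real k)\<^sup>2) \<longlonglongrightarrow> sin (pi * x) / (pi * x)"
      using sin_product_formula_real'[of x] x by simp
    \<comment> \<open>A nonzero limit lets \<open>ln\<close> pass through it. The zeros of sin(pi x)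
      are the integers, which the hypotheses exclude.\<close>
    have "sin (pi * x) / (pi * x) \<noteq> 0"
    proof
      assume "sin (pi * x) / (pi * x) = 0"
      then have "sin (pi * x) = 0" using x by simp
      then obtain i :: int where "pi * x = of_int i * pi"
        by (auto simp: sin_zero_iff_int2)
      then have "x = of_int i" by simp
      with x show False by auto
    qed
    from tendsto_minus[OF tendsto_ln[OF P this]]
    show "(\<lambda>n. \<Sum>k<n. - ln (1 - x\<^sup>2 / (real (Suc k))\<^sup>2)) \<longlonglongrightarrow> - ln (sin (pi * x) / (pi * x))"
    proof (rule Lim_transform_eventually, intro always_eventually allI)
      fix n
      have "ln (\<Prod>k=1..n. 1 - x\<^sup>2 / (real k)\<^sup>2) = (\<Sum>k=1..n. ln (1 - x\<^sup>2 / (real k)\<^sup>2))"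
      proof (rule ln_prod)
        fix k assume "k \<in> {1..n}"
        then show "1 - x\<^sup>2 / (real k)\<^sup>2 \<noteq> 0" using q(2)[of "k - 1"] by auto
      qed simp
      also have "\<dots> = (\<Sum>k<n. ln (1 - x\<^sup>2 / (real (Suc k))\<^sup>2))"
        by (rule sum.reindex_bij_witness[of _ Suc "\<lambda>k. k - 1"]) auto
      finally show "- ln (\<Prod>k=1..n. 1 - x\<^sup>2 / (real k)\<^sup>2)
                     = (\<Sum>k<n. - ln (1 - x\<^sup>2 / (real (Suc k))\<^sup>2))"
        by (simp add: sum_negf)
    qed
  qed
  then have total: "((\<lambda>n. - ln (1 - x\<^sup>2 / (real (Suc n))\<^sup>2)) has_sum
                - ln (sin (pi * x) / (pi * x))) UNIV"
    by (rule sums_nonneg_imp_has_sum) (use q in \<open>simp del: of_nat_Suc\<close>)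
  \<comment> \<open>Since the terms are nonnegative, summable rows with summable row sums give
    summability over all pairs; this justifies the exchange of summations.\<close>
  have "a summable_on UNIV \<times> UNIV"
    by (rule summable_on_SigmaI[OF rows]) (use total a_nonneg in \<open>auto simp: summable_on_def\<close>)
  then have "(a has_sum - ln (sin (pi * x) / (pi * x))) (UNIV \<times> UNIV)"
    by (intro has_sum_SigmaI[OF rows]) (use total in auto)
  then have swapped: "((\<lambda>(k, n). a (n, k)) has_sum - ln (sin (pi * x) / (pi * x))) (UNIV \<times> UNIV)"
    by (subst (asm) has_sum_swap)
  have columns: "((\<lambda>n. a (n, k)) has_sum
      (\<Sum>n. 1 / real (Suc n) ^ (2 * Suc k)) * x ^ (2 * Suc k) / real (Suc k)) UNIV" for k
  proof (rule sums_nonneg_imp_has_sum)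
    have "summable (\<lambda>n. inverse (real (Suc n) ^ (2 * Suc k)))"
      by (subst summable_Suc_iff, rule inverse_power_summable) simp
    then have "(\<lambda>n. 1 / real (Suc n) ^ (2 * Suc k)) sums (\<Sum>n. 1 / real (Suc n) ^ (2 * Suc k))"
      by (intro summable_sums) (simp only: inverse_eq_divide)
    then have "(\<lambda>n. 1 / real (Suc n) ^ (2 * Suc k) * (x ^ (2 * Suc k) / real (Suc k))) sums
       ((\<Sum>n. 1 / real (Suc n) ^ (2 * Suc k)) * (x ^ (2 * Suc k) / real (Suc k)))"
      by (rule sums_mult2)
    moreover have "a (n, k) = 1 / real (Suc n) ^ (2 * Suc k) * (x ^ (2 * Suc k) / real (Suc k))" for n
      unfolding a_def by (simp only: prod.case power_divide power_mult) simp
    ultimately show "(\<lambda>n. a (n, k)) sums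
      ((\<Sum>n. 1 / real (Suc n) ^ (2 * Suc k)) * x ^ (2 * Suc k) / real (Suc k))"
      by (simp only: times_divide_eq_right)
  qed (rule a_nonneg)
  show ?thesis
    by (rule has_sum_imp_sums, rule has_sum_SigmaD[OF swapped]) (use columns in simp)
qed

section \<open>Taylor series of the log-sine function and its logarithmic derivative\<close>

lemma has_fps_expansion_unique:
  fixes f :: "'a :: {banach, real_normed_field} \<Rightarrow> 'a"
  assumes "f has_fps_expansion F" "f has_fps_expansion G"
  shows "F = G"
proof (rule fps_ext)
  fix n
  show "fps_nth F n = fps_nth G n"
    using assms
  \<comment> \<open>The constant coefficient is the value at 0; passing to the derivative lowers the
    index by one, hence the generalisation over \<open>f\<close>.\<close>
  proof (induction n arbitrary: f F G)
    case 0
    then show ?case by (auto simp: has_fps_expansion_def eval_fps_at_0 dest!: eventually_nhds_x_imp_x)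
  next
    case (Suc n)
    have "fps_nth (fps_deriv F) n = fps_nth (fps_deriv G) n"
      by (rule Suc.IH[of "deriv f"]) (use Suc.prems in \<open>auto intro: has_fps_expansion_deriv\<close>)
    then show ?case by (simp del: of_nat_Suc)
  qed
qed

text \<open>The Taylor series at 0 of ln(sin(pi x) / (pi x)): for \<open>n = 2 * k\<close> the
  coefficient is -zeta(2k) / k.\<close>

definition fps_log_sine :: "real fps" where
  "fps_log_sine = Abs_fps (\<lambda>n. if n > 0 \<and> even n
      then - 2 * (\<Sum>m. 1 / real (Suc m) ^ n) / real n else 0)"

lemma fps_log_sine_sums:
  assumes "\<bar>x\<bar> < 1"
  shows "(\<lambda>n. fps_nth fps_log_sine n * x ^ n) sums
           (if x = 0 then 0 else ln (sin (pi * x) / (pi * x)))"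
proof (cases "x = 0")
  case True
  have "(\<lambda>n. fps_nth fps_log_sine n * x ^ n) = (\<lambda>n. 0)"
    by (auto simp: True fps_log_sine_def fun_eq_iff power_0_left)
  then show ?thesis using True by simp
next
  case False
  have g: "strict_mono (\<lambda>k. 2 * Suc k)" by (auto simp: strict_mono_def)
  have zero: "fps_nth fps_log_sine n * x ^ n = 0" if "n \<notin> range (\<lambda>k. 2 * Suc k)" for n
  proof -
    have "\<not> (n > 0 \<and> even n)"
    proof
      assume "n > 0 \<and> even n"
      then obtain k where "n = 2 * k" "k > 0" by (auto elim: evenE)
      then have "n = 2 * Suc (k - 1)" by simp
      with that show False by blast
    qed
    then show ?thesis unfolding fps_log_sine_def by auto
  qed
  have "(\<lambda>k. fps_nth fps_log_sine (2 * Suc k) * x ^ (2 * Suc k)) sums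
           ln (sin (pi * x) / (pi * x))"
  proof -
    have "fps_nth fps_log_sine (2 * Suc k) =
            - ((\<Sum>n. 1 / real (Suc n) ^ (2 * Suc k)) / real (Suc k))" for k
      by (simp add: fps_log_sine_def field_simps del: power_Suc)
    then show ?thesis
      using sums_minus[OF log_sine_zeta_series[OF assms False]]
      by (simp only: mult_minus_left times_divide_eq_left minus_minus)
  qed
  then have "(\<lambda>n. fps_nth fps_log_sine n * x ^ n) sums ln (sin (pi * x) / (pi * x))"
    by (rule iffD1[OF sums_mono_reindex[OF g], rotated]) (rule zero)
  then show ?thesis using False by simp
qed

text \<open>This is pi x cot(pi x) = 1 + x L'(x) with the denominator cleared. Differentiating
  sin(pi x) = pi x exp(L x) and multiplying by x gives it near 0; uniqueness of expansions turns it
  into an identity of series.\<close>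

lemma fps_log_sine_logarithmic_derivative:
  "fps_const pi * fps_X * fps_cos pi = fps_sin pi * (1 + fps_X * fps_deriv fps_log_sine)"
proof -
  define L where "L = eval_fps fps_log_sine"
  have near0: "eventually (\<lambda>x. x \<in> {-1<..<1::real}) (nhds 0)"
    by (intro eventually_nhds_in_open) auto
  have L: "L x = (if x = 0 then 0 else ln (sin (pi * x) / (pi * x)))" if "\<bar>x\<bar> < 1" for x
    using fps_log_sine_sums[OF that] by (simp add: L_def eval_fps_def sums_iff)
  have rad: "fps_conv_radius fps_log_sine \<ge> 1"
    unfolding fps_conv_radius_def
  proof (rule conv_radius_geI_ex')
    fix r :: real assume "0 < r" "ereal r < 1"
    then show "summable (\<lambda>n. fps_nth fps_log_sine n * of_real r ^ n)"
      using fps_log_sine_sums[of r] by (auto simp: sums_iff)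
  qed
  \<comment> \<open>The quotient is positive for nonzero x, so \<open>exp\<close> undoes
    \<open>ln\<close>; in this product form the identity also covers \<open>x = 0\<close>.\<close>
  have exp_L: "sin (pi * x) = pi * x * exp (L x)" if "\<bar>x\<bar> < 1" for x
  proof (cases "x = 0")
    case False
    have "sin (pi * \<bar>x\<bar>) > 0"
      using False that by (intro sin_gt_zero) auto
    then have "sin (pi * x) / (pi * x) > 0"
      using False by (cases "x > 0") (auto simp: zero_less_divide_iff abs_if zero_less_mult_iff mult_less_0_iff)
    then show ?thesis using False L[OF that] by simp
  qed simp
  have deriv_L: "(L has_real_derivative eval_fps (fps_deriv fps_log_sine) x) (at x)"
    if "\<bar>x\<bar> < 1" for x
    unfolding L_def
    by (rule has_field_derivative_eval_fps, rule less_le_trans[OF _ rad]) (use that in \<open>simp add: one_ereal_def\<close>)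
  have L_exp: "L has_fps_expansion fps_log_sine"
    unfolding L_def using rad by (intro eval_fps_has_fps_expansion less_le_trans[OF _ rad]) auto
  have "deriv L has_fps_expansion fps_deriv fps_log_sine"
    using L_exp by (rule has_fps_expansion_deriv)
  then have rhs: "(\<lambda>x. sin (pi * x) * (1 + x * deriv L x)) has_fps_expansion
               fps_sin pi * (1 + fps_X * fps_deriv fps_log_sine)"
    by (intro has_fps_expansion_mult has_fps_expansion_add has_fps_expansion_sin
          has_fps_expansion_1 has_fps_expansion_fps_X)
  have lhs: "(\<lambda>x. pi * x * cos (pi * x)) has_fps_expansion fps_const pi * fps_X * fps_cos pi"
    by (intro fps_expansion_intros)
  have "eventually (\<lambda>x. pi * x * cos (pi * x) = sin (pi * x) * (1 + x * deriv L x)) (nhds 0)"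
    using near0
  proof eventually_elim
    case (elim x)
    then have x: "\<bar>x\<bar> < 1" by auto
    define d where "d = deriv L x"
    have d: "(L has_real_derivative d) (at x)"
      using deriv_L[OF x] unfolding d_def by (simp add: DERIV_imp_deriv)
    have "((\<lambda>x. pi * x * exp (L x)) has_real_derivative
              pi * exp (L x) + pi * x * (exp (L x) * d)) (at x)"
      by (auto intro!: derivative_eq_intros d)
    then have "((\<lambda>x. sin (pi * x)) has_real_derivative
              pi * exp (L x) + pi * x * (exp (L x) * d)) (at x)"
      by (rule has_field_derivative_transform_within_open[of _ _ _ "{-1<..<1}"])
         (use elim exp_L in auto)
    moreover have "((\<lambda>x. sin (pi * x)) has_real_derivative pi * cos (pi * x)) (at x)"
      by (auto intro!: derivative_eq_intros)
    ultimately have "pi * cos (pi * x) = pi * exp (L x) + pi * x * (exp (L x) * d)"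
      by (rule DERIV_unique[symmetric])
    then have "x * (pi * cos (pi * x)) = pi * x * exp (L x) * (1 + x * d)"
      by (simp add: algebra_simps)
    then show ?case using exp_L[OF x] by (simp add: d_def algebra_simps)
  qed
  with rhs have "(\<lambda>x. pi * x * cos (pi * x)) has_fps_expansion
               fps_sin pi * (1 + fps_X * fps_deriv fps_log_sine)"
    by (auto simp: has_fps_expansion_def elim: eventually_elim2)
  with lhs show ?thesis by (rule has_fps_expansion_unique)
qed

section \<open>Complex coefficients and comparison with the Bernoulli series\<close>

definition fps_of_real :: "real fps \<Rightarrow> complex fps" where
  "fps_of_real F = Abs_fps (\<lambda>n. of_real (fps_nth F n))"

lemma fps_nth_fps_of_real [simp]: "fps_nth (fps_of_real F) n = of_real (fps_nth F n)"
  by (simp add: fps_of_real_def)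

lemma fps_of_real_mult: "fps_of_real (F * G) = fps_of_real F * fps_of_real G"
  by (rule fps_ext) (simp add: fps_mult_nth)

lemma fps_of_real_elementary:
  "fps_of_real (F - G) = fps_of_real F - fps_of_real G"
  "fps_of_real 1 = 1"
  "fps_of_real fps_X = fps_X"
  "fps_of_real (fps_const c) = fps_const (of_real c)"
  "fps_of_real (fps_exp c) = fps_exp (of_real c)"
  "fps_of_real (fps_sin c) = fps_sin (of_real c)"
  "fps_of_real (fps_cos c) = fps_cos (of_real c)"
  by (auto intro!: fps_ext simp: fps_X_def fps_sin_def fps_cos_def)

text \<open>With t = c x, \<open>F\<close> is pi x cot(pi x) and \<open>D\<close> is t / (exp t -
  1). Both \<open>F\<close> and \<open>D\<close> plus t/2 have the same product with exp t - 1, so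
  they coincide, and their coefficients can be compared.\<close>

lemma zeta_even_bernoulli:
  assumes k: "k > 0"
  shows "(\<Sum>n. 1 / real (Suc n) ^ (2 * k)) =
           - ((- 1) ^ k * bernoulli (2 * k) * (2 * pi) ^ (2 * k) / (2 * fact (2 * k)))"
proof -
  define c :: complex where "c = 2 * \<i> * of_real pi"
  define B :: "real fps" where "B = fps_X / (fps_exp 1 - 1)"
  define D where "D = fps_of_real B oo (fps_const c * fps_X)"
  define F where "F = fps_of_real (1 + fps_X * fps_deriv fps_log_sine)"
  \<comment> \<open>A square root of exp t: it turns exp t - 1 and exp t + 1 into multiples of the
    sine and cosine of pi x.\<close>
  define E where "E = fps_exp (\<i> * complex_of_real pi)"
  define E' where "E' = fps_exp (- (\<i> * complex_of_real pi))"
  have E2: "E * E = fps_exp c" and EE': "E * E' = 1"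
    by (simp_all add: E_def E'_def c_def fps_exp_add_mult [symmetric])
  have "subdegree (fps_exp 1 - 1 :: real fps) = 1"
    by (rule subdegreeI) auto
  then have "B * (fps_exp 1 - 1) = fps_X"
    unfolding B_def by (intro fps_times_divide_eq) auto
  then have "fps_of_real B * (fps_exp 1 - 1) = fps_X"
    by (metis fps_of_real_mult fps_of_real_elementary(1,2,3,5) of_real_1)
  then have "(fps_of_real B * (fps_exp 1 - 1)) oo (fps_const c * fps_X) = fps_X oo (fps_const c * fps_X)"
    by (rule arg_cong)
  then have "D * (fps_exp c - 1) = fps_const c * fps_X"
    by (simp add: D_def fps_compose_mult_distrib fps_compose_sub_distrib)
  then have D: "D * (E * E - 1) = fps_const c * fps_X"
    by (simp add: E2)
  have "fps_const (of_real pi) * fps_X * fps_cos (of_real pi) = fps_sin (of_real pi) * F"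
    unfolding F_def fps_of_real_elementary(3,4,6,7) [symmetric] fps_of_real_mult [symmetric]
    by (simp only: fps_log_sine_logarithmic_derivative)
  moreover define C S I where "C = fps_cos (complex_of_real pi)"
    and "S = fps_sin (complex_of_real pi)" and "I = fps_const \<i>"
  ultimately have cot: "fps_const (of_real pi) * fps_X * C = S * F"
    by simp
  have E_trig: "E = C + I * S" "E' = C - I * S"
    using fps_exp_ii_sin_cos[of "of_real pi"] fps_exp_ii_sin_cos[of "- of_real pi"]
    by (simp_all add: E_def E'_def C_def S_def I_def fps_cos_odd fps_sin_even)
  \<comment> \<open>Replace 1 by \<open>E * E'\<close> and factor out \<open>E\<close>; the other
    factors are \<open>E + E' = 2 * C\<close> and \<open>E - E' = 2 * I * S\<close>.\<close>
  have plus: "E * E + 1 = 2 * E * C" and minus: "E * E - 1 = 2 * I * E * S"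
    using EE' unfolding E_trig by algebra+
  have half: "fps_const (c / 2) = I * fps_const (of_real pi)"
    by (simp add: I_def c_def)
  have F: "F * (E * E - 1) = fps_const (c / 2) * fps_X * (E * E + 1)"
    unfolding plus minus half using cot by algebra
  have "fps_const c = fps_const (c / 2) + fps_const (c / 2)"
    by simp
  then have "(D + fps_const (c / 2) * fps_X) * (E * E - 1) = F * (E * E - 1)"
    using D unfolding F by algebra
  \<comment> \<open>Formal power series over a field have no zero divisors, so this nonzero factor
    cancels.\<close>
  moreover have "E * E - 1 \<noteq> 0"
    unfolding E2 by (simp add: c_def flip: fps_exp_0)
  ultimately have "F = D + fps_const (c / 2) * fps_X"
    by simp
  \<comment> \<open>The correction t/2 only affects the coefficient of index 1.\<close>
  then have "fps_nth F (2 * k) = fps_nth D (2 * k)"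
    using k by simp
  moreover have "fps_nth F (2 * k) = of_real (- 2 * (\<Sum>n. 1 / real (Suc n) ^ (2 * k)))"
    using k unfolding F_def by (simp add: fps_log_sine_def del: of_nat_Suc)
  \<comment> \<open>Substituting c x scales this coefficient by
    \<open>c ^ (2 * k) = (- 4 * pi^2) ^ k\<close>, the source of the alternating sign.\<close>
  moreover have "fps_nth D (2 * k) =
      of_real ((- 1) ^ k * bernoulli (2 * k) * (2 * pi) ^ (2 * k) / fact (2 * k))"
    unfolding D_def by (simp add: c_def B_def bernoulli_def power_mult power_mult_distrib
        power_minus[of "4 * (complex_of_real pi)\<^sup>2"])
  ultimately have "- 2 * (\<Sum>n. 1 / real (Suc n) ^ (2 * k)) =
      (- 1) ^ k * bernoulli (2 * k) * (2 * pi) ^ (2 * k) / fact (2 * k)"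
    by (simp only: of_real_eq_iff)
  then show ?thesis by (simp add: field_simps)
qed

section \<open>Zeta at integers and evaluation at x = 1/2\<close>

lemma zeta_of_nat:
  assumes "m \<ge> 2"
  shows "zeta (of_nat m) = of_real (\<Sum>n. 1 / real (Suc n) ^ m)"
proof -
  have "summable (\<lambda>n. inverse (real (Suc n) ^ m))"
    by (subst summable_Suc_iff, rule inverse_power_summable) fact
  then have "summable (\<lambda>n. 1 / real (Suc n) ^ m)"
    by (simp only: inverse_eq_divide)
  then have "of_real (\<Sum>n. 1 / real (Suc n) ^ m) = (\<Sum>n. complex_of_real (1 / real (Suc n) ^ m))"
    by (rule suminf_of_real)
  \<comment> \<open>At a natural exponent the complex \<open>powr\<close> is an ordinary power,
    which links the Dirichlet series to the real sums used so far.\<close>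
  moreover have "complex_of_real (1 / real (Suc n) ^ m) = of_nat (Suc n) powr (- of_nat m)" for n
    by (simp add: powr_minus powr_nat' inverse_eq_divide del: of_nat_Suc)
  ultimately show ?thesis by (simp add: zeta_def)
qed

theorem mainTheorem2:
  shows "(summable (\<lambda>k. zeta (2 * of_nat (Suc k)) / (4 ^ Suc k * of_nat (Suc k))) \<and>
          complex_of_real (ln (pi / 2)) =
            (\<Sum>k. zeta (2 * of_nat (Suc k)) / (4 ^ Suc k * of_nat (Suc k)))) \<and>
         (summable (\<lambda>k. (-1) ^ Suc k * bernoulli (2 * Suc k) /
            (2 * real (Suc k) * fact (2 * Suc k)) * pi ^ (2 * Suc k)) \<and>
          ln (pi / 2) =
            - (\<Sum>k. (-1) ^ Suc k * bernoulli (2 * Suc k) /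
                 (2 * real (Suc k) * fact (2 * Suc k)) * pi ^ (2 * Suc k)))"
proof -
  define z where "z k = (\<Sum>n. 1 / real (Suc n) ^ (2 * Suc k))" for k
  have ln_half: "- ln (sin (pi * (1/2)) / (pi * (1/2))) = ln (pi / 2)"
    by (simp add: ln_div)
  have "(1/2 :: real) ^ (2 * Suc k) = 1 / 4 ^ Suc k" for k
    by (simp only: power_mult) (simp add: power_divide)
  then have S: "(\<lambda>k. z k / (4 ^ Suc k * real (Suc k))) sums ln (pi / 2)"
    using log_sine_zeta_series[of "1/2"] unfolding ln_half
    by (simp add: z_def mult.commute mult.left_commute del: of_nat_Suc power_Suc mult_Suc_right)
  have "zeta (2 * of_nat (Suc k)) = of_real (z k)" for k
    using zeta_of_nat[of "2 * Suc k"] by (simp add: z_def del: mult_Suc_right of_nat_Suc)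
  then have "(\<lambda>k. zeta (2 * of_nat (Suc k)) / (4 ^ Suc k * of_nat (Suc k))) sums
              of_real (ln (pi / 2))"
    using sums_of_real[OF S, where 'a = complex] by (simp del: of_nat_Suc power_Suc)
  moreover have "z k / (4 ^ Suc k * real (Suc k)) =
      - ((-1) ^ Suc k * bernoulli (2 * Suc k) / (2 * real (Suc k) * fact (2 * Suc k)) * pi ^ (2 * Suc k))" for k
  proof -
    \<comment> \<open>The factor \<open>4 ^ Suc k\<close> from the Bernoulli formula cancels the one
      in the denominator of the first series.\<close>
    have "(2 * pi) ^ (2 * Suc k) = 4 ^ Suc k * pi ^ (2 * Suc k)"
      by (simp only: power_mult_distrib power_mult) simp
    then show ?thesis
      unfolding z_def zeta_even_bernoulli[OF zero_less_Suc]
      by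
        (simp del: power_Suc of_nat_Suc mult_Suc_right fact_Suc add: field_simps)
  qed
  from sums_minus[OF S[unfolded this]]
  have "(\<lambda>k. (-1) ^ Suc k * bernoulli (2 * Suc k) /
            (2 * real (Suc k) * fact (2 * Suc k)) * pi ^ (2 * Suc k)) sums - ln (pi / 2)"
    by (simp only: minus_minus)
  ultimately show ?thesis by (simp add: sums_iff del: of_nat_Suc power_Suc mult_Suc_right fact_Suc)
qed

end
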